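(* Let $\mathcal{H}$ be a real Hilbert space, let $m$ be a natural number, and for each $i\in\{1,\dots,m\}$ let $C_i=\bigcup_{j=1}^{m_i}C_{i,j}\subset\mathcal{H}$ be a UCS set (a finite union of pairwise disjoint nonempty closed convex sets $C_{i,1},\dots,C_{i,m_i}$). Put $C_{m+1}:=C_1$, $m_{m+1}:=m_1$ and $C_{m+1,j}:=C_{1,j}$ for all $j\in\{1,\dots,m_1\}$. Assume that $C:=\bigcap_{i=1}^m C_i\neq\emptyset$. Assume moreover that for each $i\in\{1,\dots,m\}$ and each $j\in\{1,\dots,m_i\}$ there exists a unique integer $\theta(i,j)\in\{1,\dots,m_{i+1}\}$ such that for every $x\in C_{i,j}$ $$P_{C_{i+1}}(x)=P_{C_{i+1,\theta(i,j)}}(x)$$ and $$dist(x,C_{i+1,\theta(i,j)})<dist(x,C_{i+1,\ell})\quad\text{for all }\ell\in\{1,\dots,m_{i+1}\}\setminus\{\theta(i,j)\}.$$ Let $r\in\{1,\dots,m_1\}$ be such that $C\cap C_{1,r}\neq\emptyset$, and let $\{y_r^k\}_{k=1}^\infty$ be a sequence generated by the PUCS Algorithm (described in the context). Then $$\lim_{k\to\infty}\|y_r^k-y_r^{k+1}\|=0$$ and, for each $i\in\{1,\dots,m\}$, $$\lim_{k\to\infty}dist(y_r^k,C_i)=0.$$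
   Context: $\mathcal{H}$ is a real Hilbert space with inner product $\langle\cdot,\cdot\rangle$ and norm $\|x\|=\langle x,x\rangle^{1/2}$. For $x\in\mathcal{H}$ and nonempty $\Omega\subset\mathcal{H}$, $dist(x,\Omega):=\inf\{\|x-y\|\mid y\in\Omega\}$. If $\Omega$ is nonempty, closed and convex, $P_\Omega(x)$ is the unique point of $\Omega$ with $\|x-P_\Omega(x)\|=dist(x,\Omega)$. UCS set: let $m_\Omega$ be a natural number and let $\Omega_1,\dots,\Omega_{m_\Omega}\subset\mathcal{H}$ be nonempty closed convex sets that are pairwise disjoint ($\Omega_s\cap\Omega_t=\emptyset$ for $s\neq t$); the union $\Omega=\bigcup_{s=1}^{m_\Omega}\Omega_s$ is called a union of convex sets (UCS) set. For a UCS set $\Omega$ and $x\in\mathcal{H}$, the (possibly multivalued) projection is the nonempty set $P_\Omega(x):=\{y\in\Omega\mid \|x-y\|\le\|z-x\|\text{ for all }z\in\Omega\}$. When this set is a singleton it is identified with its unique element; in particular, the equality $P_{C_{i+1}}(x)=P_{C_{i+1,\theta(i,j)}}(x)$ means that $P_{C_{i+1}}(x)$ is the singleton consisting of the projection of $x$ onto the closed convex set $C_{i+1,\theta(i,j)}$. Control sequence: $i(k):=((k-1)\bmod m)+1\in\{1,\dots,m\}$ for every natural number $k\ge 1$. PUCS Algorithm (Projections onto Unions of Convex Sets): (1) Initialization: for each $r\in\{1,\dots,m_1\}$ pick an arbitrary point $y_r^1\in C_{1,r}$ and set $\tau(r,1):=r$. (2) First sweep: for each $r\in\{1,\dots,m_1\}$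 and for $k=1,2,\dots,m$, compute $y_r^{k+1}=P_{C_{i(k+1)}}(y_r^k)$ and denote by $\tau(r,k+1)\in\{1,\dots,m_{i(k+1)}\}$ the index of the set among $C_{i(k+1),1},\dots,C_{i(k+1),m_{i(k+1)}}$ that is closest to $y_r^k$, so that $y_r^{k+1}=P_{C_{i(k+1),\tau(r,k+1)}}(y_r^k)$. After these $m$ steps one has $y_r^{m+1}=P_{C_1}(y_r^m)$ and $\tau(r,m+1)$ for each $r$. Define $R:=\{r\in\{1,\dots,m_1\}\mid \tau(r,m+1)\neq r\}$. (3) Iterative step: for every $r\in\{1,\dots,m_1\}\setminus R$, reset $y_r^1$ to be the point $y_r^{m+1}$ obtained in step (2), and for all $k\ge1$ compute $y_r^{k+1}=P_{C_{i(k+1)}}(y_r^k)$, denoting by $\tau(r,k+1)\in\{1,\dots,m_{i(k+1)}\}$ the index of the set in the union $C_{i(k+1)}$ closest to $y_r^k$, so that $y_r^{k+1}=P_{C_{i(k+1),\tau(r,k+1)}}(y_r^k)$. The sequence $\{y_r^k\}_{k=1}^\infty$ generated by the algorithm for the index $r$ is the infinite sequence produced in step (3). *)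

theory Defs
  imports "HOL-Analysis.Analysis"
begin

definition ucs_family :: "nat \<Rightarrow> (nat \<Rightarrow> 'a::real_inner set) \<Rightarrow> bool" where
  "ucs_family n S \<longleftrightarrow>
     1 \<le> n \<and>
     (\<forall>s\<in>{1..n}. S s \<noteq> {} \<and> closed (S s) \<and> convex (S s)) \<and>
     disjoint_family_on S {1..n}"

definition ucs_union :: "nat \<Rightarrow> (nat \<Rightarrow> 'a set) \<Rightarrow> 'a set" where
  "ucs_union n S = (\<Union>s\<in>{1..n}. S s)"

text \<open>The distance from a point to a nonempty set is the library function \<^const>\<open>infdist\<close>.
  The library's \<^const>\<open>closest_point\<close> is restricted to the class \<^class>\<open>heine_borel\<close>, which
  excludes infinite-dimensional spaces.\<close>

definition convex_proj :: "'a::real_inner set \<Rightarrow> 'a \<Rightarrow> 'a" where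
  "convex_proj S x = (THE p. p \<in> S \<and> norm (x - p) = infdist x S)"

definition ucs_proj :: "'a::real_inner set \<Rightarrow> 'a \<Rightarrow> 'a set" where
  "ucs_proj S x = {y \<in> S. \<forall>z\<in>S. norm (x - y) \<le> norm (z - x)}"

text \<open>Sequences are indexed from 1; values at index 0 are irrelevant throughout.\<close>

definition control :: "nat \<Rightarrow> nat \<Rightarrow> nat" where
  "control m k = (k - 1) mod m + 1"

text \<open>One step, producing the \<open>k\<close>-th iterate \<open>x'\<close> from its predecessor \<open>x\<close>. The equation
  \<open>x' = P(x)\<close> for the set-valued projection says that \<open>P(x)\<close> is the singleton of \<open>x'\<close>; together
  with \<open>t\<close> being an index of a closest set, this makes \<open>x'\<close> the projection of \<open>x\<close>
  onto the \<open>t\<close>-th set.\<close>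

definition pucs_step ::
    "nat \<Rightarrow> (nat \<Rightarrow> nat) \<Rightarrow> (nat \<Rightarrow> nat \<Rightarrow> 'a::real_inner set) \<Rightarrow> nat \<Rightarrow> 'a \<Rightarrow> 'a \<Rightarrow> nat \<Rightarrow> bool" where
  "pucs_step m M C k x x' t \<longleftrightarrow>
     (let i = control m k in
        ucs_proj (ucs_union (M i) (C i)) x = {x'} \<and>
        is_arg_min (\<lambda>l. infdist x (C i l)) (\<lambda>l. l \<in> {1..M i}) t)"

definition pucs_first_sweep ::
    "nat \<Rightarrow> (nat \<Rightarrow> nat) \<Rightarrow> (nat \<Rightarrow> nat \<Rightarrow> 'a::real_inner set) \<Rightarrow>
     (nat \<Rightarrow> nat \<Rightarrow> 'a) \<Rightarrow> (nat \<Rightarrow> nat \<Rightarrow> nat) \<Rightarrow> bool" where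
  "pucs_first_sweep m M C w \<sigma> \<longleftrightarrow>
     (\<forall>r\<in>{1..M 1}. w r 1 \<in> C 1 r \<and> \<sigma> r 1 = r \<and>
        (\<forall>k\<in>{1..m}. pucs_step m M C (k + 1) (w r k) (w r (k + 1)) (\<sigma> r (k + 1))))"

definition pucs_rejected :: "nat \<Rightarrow> (nat \<Rightarrow> nat) \<Rightarrow> (nat \<Rightarrow> nat \<Rightarrow> nat) \<Rightarrow> nat set" where
  "pucs_rejected m M \<sigma> = {r \<in> {1..M 1}. \<sigma> r (m + 1) \<noteq> r}"

text \<open>A complete run: \<open>w\<close> and \<open>\<sigma>\<close> are the points and indices of the first sweep, \<open>y\<close> and \<open>\<tau>\<close>
  those of the iterative step (the algorithm overwrites the former by the latter).
  For a rejected index \<open>r\<close> the iterative step is not performed, so nothing at all is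
  required of \<open>y r\<close> and \<open>\<tau> r\<close>.\<close>

definition pucs_run ::
    "nat \<Rightarrow> (nat \<Rightarrow> nat) \<Rightarrow> (nat \<Rightarrow> nat \<Rightarrow> 'a::real_inner set) \<Rightarrow>
     (nat \<Rightarrow> nat \<Rightarrow> 'a) \<Rightarrow> (nat \<Rightarrow> nat \<Rightarrow> nat) \<Rightarrow>
     (nat \<Rightarrow> nat \<Rightarrow> 'a) \<Rightarrow> (nat \<Rightarrow> nat \<Rightarrow> nat) \<Rightarrow> bool" where
  "pucs_run m M C w \<sigma> y \<tau> \<longleftrightarrow>
     pucs_first_sweep m M C w \<sigma> \<and>
     (\<forall>r\<in>{1..M 1} - pucs_rejected m M \<sigma>.
        y r 1 = w r (m + 1) \<and> \<tau> r 1 = \<sigma> r 1 \<and>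
        (\<forall>k\<ge>1. pucs_step m M C (k + 1) (y r k) (y r (k + 1)) (\<tau> r (k + 1))))"

end

theory Submission
  imports Defs
begin

text \<open>Let \<open>z\<close> be a common point of \<open>C\<close> and \<open>C 1 r\<close>. Since \<open>z\<close> has distance 0 to each
  union, the strictly closest component to the component carrying \<open>z\<close> must again contain \<open>z\<close>.
  So the iterates always lie in the component that contains \<open>z\<close>; in particular \<open>r\<close> is not
  rejected, and each step is a projection onto a convex set containing \<open>z\<close>. Firm
  nonexpansiveness makes the squared distances to \<open>z\<close> telescope, so consecutive iterates
  approach each other, and every \<open>C i\<close> is visited within any \<open>m\<close> consecutive steps.\<close>

text \<open>If \<open>x - p\<close> made an acute angle with \<open>z - p\<close>, a short move from
  \<open>p\<close> towards \<open>z\<close> would stay in the convex set and come closer to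
  \<open>x\<close>. So the inner product is at most 0, and expanding the square of
  \<open>x - z = (x - p) + (p - z)\<close> gives the bound.\<close>

lemma convex_nearest_point_Pythagoras:
  fixes S :: "'a::real_inner set"
  assumes "convex S" "p \<in> S" "z \<in> S" "\<And>q. q \<in> S \<Longrightarrow> norm (x - p) \<le> norm (q - x)"
  shows "(norm (x - p))\<^sup>2 \<le> (norm (x - z))\<^sup>2 - (norm (p - z))\<^sup>2"
proof -
  have "inner (x - p) (z - p) \<le> 0"
  proof (rule ccontr)
    assume "\<not> ?thesis"
    then obtain u where "u > 0" "u \<le> 1" and u: "dist (p + u *\<^sub>R (z - p)) x < dist p x"
      using closer_point_lemma[of x p z] by (auto simp: dist_commute)
    then have "p + u *\<^sub>R (z - p) \<in> S"
      using assms(1-3) convexD_alt[of S p z u] by (simp add: algebra_simps)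
    with u assms(4) show False
      by (metis dist_norm norm_minus_commute not_less)
  qed
  moreover have "(norm (x - z))\<^sup>2 = (norm (x - p))\<^sup>2 + (norm (p - z))\<^sup>2 - 2 * inner (x - p) (z - p)"
    by (simp add: power2_norm_eq_inner algebra_simps inner_commute)
  ultimately show ?thesis by linarith
qed

lemma infdist_union_ge_if_nearest:
  assumes "p \<in> ucs_proj S x" "T \<subseteq> S" "T \<noteq> {}"
  shows "norm (x - p) \<le> infdist x T"
  using assms unfolding infdist_notempty[OF assms(3)] ucs_proj_def
  by (auto intro!: cINF_greatest simp: dist_norm norm_minus_commute)

text \<open>A nearest point of the union is no farther from \<open>x\<close> than any component, so
  the component carrying it attains the least distance; strictness leaves only
  \<open>S t\<close>.\<close>

lemma ucs_proj_in_strictly_closest: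
  assumes p: "p \<in> ucs_proj (ucs_union n S) x" and t: "t \<in> {1..n}" "S t \<noteq> {}"
    and closest: "\<forall>l\<in>{1..n} - {t}. infdist x (S t) < infdist x (S l)"
  shows "p \<in> S t"
proof -
  obtain l where l: "l \<in> {1..n}" "p \<in> S l"
    using p by (auto simp: ucs_proj_def ucs_union_def)
  have "infdist x (S l) \<le> norm (x - p)"
    using infdist_le[OF l(2), of x] by (simp add: dist_norm)
  also have "\<dots> \<le> infdist x (S t)"
    using t by (intro infdist_union_ge_if_nearest[OF p]) (auto simp: ucs_union_def)
  finally have "l = t"
    using l(1) closest by (meson DiffI not_less singletonD)
  with l(2) show ?thesis by simp
qed

lemma strictly_closest_contains:
  assumes "z \<in> ucs_union n S" "\<forall>l\<in>{1..n} - {t}. infdist z (S t) < infdist z (S l)"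
  shows "z \<in> S t"
proof -
  obtain s where s: "s \<in> {1..n}" "z \<in> S s"
    using assms(1) by (auto simp: ucs_union_def)
  then have "infdist z (S s) = 0" by simp
  then have "\<not> infdist z (S t) < infdist z (S s)"
    using infdist_nonneg[of z "S t"] by simp
  then have "s = t"
    using assms(2) s(1) by blast
  with s show ?thesis by simp
qed

text \<open>This identifies the index recorded by the algorithm with the index \<theta> of the
  hypothesis.\<close>

lemma strictly_closest_eq_arg_min:
  assumes "is_arg_min (\<lambda>l. infdist x (S l)) (\<lambda>l. l \<in> {1..n}) s" "t \<in> {1..n}"
    "\<forall>l\<in>{1..n} - {t}. infdist x (S t) < infdist x (S l)"
  shows "s = t"
  using assms unfolding is_arg_min_def by blast

lemma control_bounds: "1 \<le> m \<Longrightarrow> control m k \<in> {1..m}"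
  by (simp add: control_def Suc_leI)

text \<open>Truncated subtraction makes \<open>control m 0\<close> equal to
  \<open>control m 1\<close>, hence the bound \<open>1 \<le> k\<close>.\<close>

lemma control_Suc:
  assumes "1 \<le> m" "1 \<le> k"
  shows "control m (k + 1) = (if control m k = m then 1 else control m k + 1)"
proof -
  obtain n where "k = Suc n" using assms(2) by (cases k) auto
  with assms(1) show ?thesis by (auto simp: control_def mod_Suc)
qed

lemma control_hits:
  assumes "i \<in> {1..m}" "1 \<le> k"
  obtains l where "l < m" "control m (k + l) = i"
proof
  \<comment> \<open>Modulo \<open>m\<close>, the term \<open>(m - 1) * (k - 1)\<close> stands for
    \<open>-(k - 1)\<close>, so adding \<open>k - 1\<close> leaves \<open>i - 1\<close> without any
    natural-number subtraction of \<open>k\<close>.\<close>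
  let ?l = "(i - 1 + (m - 1) * (k - 1)) mod m"
  show "?l < m" using assms by simp
  have "k + ?l - 1 = k - 1 + ?l" using assms(2) by simp
  then have "(k + ?l - 1) mod m = (k - 1 + (i - 1 + (m - 1) * (k - 1))) mod m"
    by (simp add: mod_add_right_eq)
  also have "k - 1 + (i - 1 + (m - 1) * (k - 1)) = i - 1 + m * (k - 1)"
    using assms(1) by (cases m) auto
  also have "\<dots> mod m = (i - 1) mod m" by (rule mod_mult_self2)
  also have "\<dots> = i - 1" using assms(1) by (intro mod_less) auto
  finally show "control m (k + ?l) = i"
    using assms(1) by (simp add: control_def)
qed

lemma dist_le_sum_steps:
  fixes y :: "nat \<Rightarrow> 'a::metric_space"
  shows "dist (y k) (y (k + l)) \<le> (\<Sum>j<l. dist (y (k + j)) (y (k + j + 1)))"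
proof (induction l)
  case (Suc l)
  then show ?case
    using dist_triangle[of "y k" "y (k + Suc l)" "y (k + l)"] by simp
qed simp

text \<open>The squared distances to \<open>z\<close> decrease and are bounded below by 0, so they
  converge; their successive differences tend to 0 and dominate the squared step lengths.\<close>

lemma Fejer_telescoping:
  fixes y :: "nat \<Rightarrow> 'a::real_normed_vector"
  assumes "\<And>k. 1 \<le> k \<Longrightarrow>
    (norm (y k - y (k + 1)))\<^sup>2 \<le> (norm (y k - z))\<^sup>2 - (norm (y (k + 1) - z))\<^sup>2"
  shows "(\<lambda>k. norm (y k - y (k + 1))) \<longlonglongrightarrow> 0"
proof -
  \<comment> \<open>The shift by \<open>Suc\<close> skips index 0, where nothing is assumed; it is
    undone at the end.\<close>
  let ?a = "\<lambda>k. (norm (y (Suc k) - z))\<^sup>2"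
  have step: "(norm (y (Suc k) - y (Suc (Suc k))))\<^sup>2 \<le> ?a k - ?a (Suc k)" for k
    using assms[of "Suc k"] by simp
  have "decseq ?a"
    unfolding decseq_Suc_iff using step zero_le_power2
    by (metis diff_ge_0_iff_ge order_trans)
  then obtain L where L: "?a \<longlonglongrightarrow> L"
    using decseq_convergent[of ?a 0] by auto
  have "(\<lambda>k. ?a k - ?a (Suc k)) \<longlonglongrightarrow> 0"
    using tendsto_diff[OF L LIMSEQ_Suc[OF L]] by simp
  then have "(\<lambda>k. (norm (y (Suc k) - y (Suc (Suc k))))\<^sup>2) \<longlonglongrightarrow> 0"
    by (rule Lim_null_comparison[rotated]) (use step in auto)
  then have "(\<lambda>k. norm (y (Suc k) - y (Suc (Suc k)))) \<longlonglongrightarrow> 0"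
    using tendsto_real_sqrt[of _ 0] by fastforce
  then show ?thesis
    by (intro LIMSEQ_imp_Suc[of "\<lambda>k. norm (y k - y (k + 1))"]) simp
qed

theorem theorem4p2:
  fixes m r :: nat
    and M :: "nat \<Rightarrow> nat"
    and C :: "nat \<Rightarrow> nat \<Rightarrow> 'a::{real_inner,complete_space} set"
    and w y :: "nat \<Rightarrow> nat \<Rightarrow> 'a"
    and \<sigma> \<tau> :: "nat \<Rightarrow> nat \<Rightarrow> nat"
  assumes "1 \<le> m"
    and "\<forall>i\<in>{1..m}. ucs_family (M i) (C i)"
    and "M (m + 1) = M 1"
    and "\<forall>j\<in>{1..M 1}. C (m + 1) j = C 1 j"
    and "(\<Inter>i\<in>{1..m}. ucs_union (M i) (C i)) \<noteq> {}"
    and "\<forall>i\<in>{1..m}. \<forall>j\<in>{1..M i}. \<exists>!\<theta>. \<theta> \<in> {1..M (i + 1)} \<and>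
           (\<forall>x\<in>C i j.
              ucs_proj (ucs_union (M (i + 1)) (C (i + 1))) x = {convex_proj (C (i + 1) \<theta>) x} \<and>
              (\<forall>l\<in>{1..M (i + 1)} - {\<theta>}. infdist x (C (i + 1) \<theta>) < infdist x (C (i + 1) l)))"
    and "r \<in> {1..M 1}"
    and "(\<Inter>i\<in>{1..m}. ucs_union (M i) (C i)) \<inter> C 1 r \<noteq> {}"
    and "pucs_run m M C w \<sigma> y \<tau>"
  shows "(\<lambda>k. norm (y r k - y r (k + 1))) \<longlonglongrightarrow> 0 \<and>
         (\<forall>i\<in>{1..m}. (\<lambda>k. infdist (y r k) (ucs_union (M i) (C i))) \<longlonglongrightarrow> 0)"
proof -
  obtain z where z: "z \<in> (\<Inter>i\<in>{1..m}. ucs_union (M i) (C i))" "z \<in> C 1 r"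
    using assms(8) by blast
  have fam: "ucs_family (M i) (C i)" if "i \<in> {1..m}" for i
    using assms(2) that by blast
  \<comment> \<open>The hypothesis on \<theta> speaks of \<open>i + 1\<close>, the algorithm of the
    cyclic successor \<open>i'\<close>. At \<open>i = m\<close> the families are known to agree only
    on valid indices.\<close>
  have wrap: "M (i + 1) = M i' \<and> (\<forall>j\<in>{1..M i'}. C (i + 1) j = C i' j)"
    if "i' = (if i = m then 1 else i + 1)" for i i'
    using assms(3,4) that by auto
  have next_component: "\<exists>t\<in>{1..M i'}. x' \<in> C i' t \<and> z \<in> C i' t \<and> s = t \<and>
      (norm (x - x'))\<^sup>2 \<le> (norm (x - z))\<^sup>2 - (norm (x' - z))\<^sup>2"
    if k: "1 \<le> k" and i: "i = control m k" and i': "i' = control m (k + 1)"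
      and j: "j \<in> {1..M i}" "x \<in> C i j" "z \<in> C i j"
      and step: "pucs_step m M C (k + 1) x x' s" for k i i' j x x' s
  proof -
    have im: "i \<in> {1..m}" "i' \<in> {1..m}"
      using control_bounds[OF assms(1)] i i' by auto
    have ii': "i' = (if i = m then 1 else i + 1)"
      using control_Suc[OF assms(1) k] i i' by simp
    \<comment> \<open>One index serves all points of \<open>C i j\<close>, hence both the iterate
      \<open>x\<close> and the point \<open>z\<close>; this is what keeps them in a common
      component.\<close>
    obtain t where t: "t \<in> {1..M (i + 1)}"
      and cl: "\<forall>x\<in>C i j. \<forall>l\<in>{1..M (i + 1)} - {t}. infdist x (C (i + 1) t) < infdist x (C (i + 1) l)"
      using assms(6) im j(1) by blast
    have t': "t \<in> {1..M i'}" using t wrap[OF ii'] by simp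
    have cl': "\<forall>l\<in>{1..M i'} - {t}. infdist x (C i' t) < infdist x (C i' l)" if "x \<in> C i j" for x
      using cl that t t' wrap[OF ii'] by auto
    have P: "x' \<in> ucs_proj (ucs_union (M i') (C i')) x"
      and s: "is_arg_min (\<lambda>l. infdist x (C i' l)) (\<lambda>l. l \<in> {1..M i'}) s"
      using step i' by (auto simp: pucs_step_def Let_def)
    have St: "C i' t \<noteq> {}" "convex (C i' t)"
      using fam[OF im(2)] t' by (auto simp: ucs_family_def)
    have x': "x' \<in> C i' t"
      by (rule ucs_proj_in_strictly_closest[OF P t' St(1) cl'[OF j(2)]])
    have z': "z \<in> C i' t"
      using z(1) im(2) by (intro strictly_closest_contains[OF _ cl'[OF j(3)]]) blast
    have st: "s = t"
      by (rule strictly_closest_eq_arg_min[OF s t' cl'[OF j(2)]])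
    \<comment> \<open>Being nearest in the whole union, \<open>x'\<close> is nearest in the convex
      component \<open>C i' t\<close>, which also contains \<open>z\<close>.\<close>
    have "(norm (x - x'))\<^sup>2 \<le> (norm (x - z))\<^sup>2 - (norm (x' - z))\<^sup>2"
      by (rule convex_nearest_point_Pythagoras[OF St(2) x' z'])
        (use P t' in \<open>auto simp: ucs_proj_def ucs_union_def\<close>)
    with t' x' z' st show ?thesis by blast
  qed
  \<comment> \<open>The invariant hides the component index, which may change at every step.\<close>
  define good where "good i x \<longleftrightarrow> (\<exists>j\<in>{1..M i}. x \<in> C i j \<and> z \<in> C i j)" for i x
  have good_step: "good (control m (k + 1)) x' \<and>
      (norm (x - x'))\<^sup>2 \<le> (norm (x - z))\<^sup>2 - (norm (x' - z))\<^sup>2"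
    if "1 \<le> k" "good (control m k) x" "pucs_step m M C (k + 1) x x' s" for k x x' s
    using next_component[OF that(1) refl refl _ _ _ that(3)] that(2) unfolding good_def by blast

  have sweep: "w r 1 \<in> C 1 r" "\<And>k. k \<in> {1..m} \<Longrightarrow> pucs_step m M C (k + 1) (w r k) (w r (k + 1)) (\<sigma> r (k + 1))"
    using assms(7,9) by (auto simp: pucs_run_def pucs_first_sweep_def)
  have control1: "control m 1 = 1" "control m (m + 1) = 1"
    by (simp_all add: control_def)
  have good_w: "good (control m k) (w r k)" if "1 \<le> k" "k \<le> m + 1" for k
    using that
  proof (induction k rule: dec_induct)
    case base
    then show ?case using assms(7) sweep(1) z(2) control1 by (auto simp: good_def)
  next
    case (step k)
    then show ?case using good_step[OF _ _ sweep(2)[of k]] by simp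
  qed
  \<comment> \<open>After \<open>m\<close> steps the control index is 1 again, so the recorded
    component of \<open>C 1\<close> contains \<open>z\<close>, as does \<open>C 1 r\<close>;
    disjointness makes them equal.\<close>
  have "\<sigma> r (m + 1) = r"
  proof -
    obtain j where j: "j \<in> {1..M (control m m)}" "w r m \<in> C (control m m) j" "z \<in> C (control m m) j"
      using good_w[of m] assms(1) by (auto simp: good_def)
    have "\<exists>t\<in>{1..M 1}. z \<in> C 1 t \<and> \<sigma> r (m + 1) = t"
      using next_component[OF assms(1) refl control1(2)[symmetric] j sweep(2)[of m]] assms(1) by auto
    moreover have "disjoint_family_on (C 1) {1..M 1}"
      using fam[of 1] assms(1) by (simp add: ucs_family_def)
    ultimately show ?thesis
      using z(2) assms(7) unfolding disjoint_family_on_def by blast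
  qed
  then have "r \<in> {1..M 1} - pucs_rejected m M \<sigma>"
    using assms(7) by (simp add: pucs_rejected_def)
  then have y1: "y r 1 = w r (m + 1)"
    and y_step: "\<And>k. 1 \<le> k \<Longrightarrow> pucs_step m M C (k + 1) (y r k) (y r (k + 1)) (\<tau> r (k + 1))"
    using assms(9) by (auto simp: pucs_run_def)
  have good_y: "good (control m k) (y r k)" if "1 \<le> k" for k
    using that
  proof (induction k rule: dec_induct)
    case base
    \<comment> \<open>The restart point comes from sweep position \<open>m + 1\<close>, whose
      control index is 1, as required at position 1.\<close>
    then show ?case using good_w[of "m + 1"] y1 control1 by simp
  next
    case (step k)
    then show ?case using good_step[OF _ _ y_step[of k]] by simp
  qed
  have lim: "(\<lambda>k. norm (y r k - y r (k + 1))) \<longlonglongrightarrow> 0"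
    using good_step[OF _ good_y y_step] by (intro Fejer_telescoping[of _ z]) blast
  moreover have "(\<lambda>k. infdist (y r k) (ucs_union (M i) (C i))) \<longlonglongrightarrow> 0" if i: "i \<in> {1..m}" for i
  proof (rule Lim_null_comparison)
    \<comment> \<open>The comparison function is the length of the next \<open>m\<close> steps: a
      sum of a fixed number of null sequences.\<close>
    have "(\<lambda>k. \<Sum>j<m. dist (y r (k + j)) (y r (k + j + 1))) \<longlonglongrightarrow> (\<Sum>j<m. 0)"
      using LIMSEQ_ignore_initial_segment[OF lim] by (intro tendsto_sum) (simp add: dist_norm)
    then show "(\<lambda>k. \<Sum>j<m. dist (y r (k + j)) (y r (k + j + 1))) \<longlonglongrightarrow> 0" by simp
    show "\<forall>\<^sub>F k in sequentially. norm (infdist (y r k) (ucs_union (M i) (C i)))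
        \<le> (\<Sum>j<m. dist (y r (k + j)) (y r (k + j + 1)))"
      using eventually_ge_at_top[of 1]
    proof eventually_elim
      case (elim k)
      obtain l where l: "l < m" "control m (k + l) = i"
        using control_hits[OF i elim] .
      have "y r (k + l) \<in> ucs_union (M i) (C i)"
        using good_y[of "k + l"] elim l(2) by (auto simp: good_def ucs_union_def)
      then have "infdist (y r k) (ucs_union (M i) (C i)) \<le> dist (y r k) (y r (k + l))"
        by (rule infdist_le)
      also have "\<dots> \<le> (\<Sum>j<l. dist (y r (k + j)) (y r (k + j + 1)))"
        by (rule dist_le_sum_steps)
      \<comment> \<open>Since \<open>l\<close> varies with \<open>k\<close>, the sum is enlarged to
        the fixed length \<open>m\<close>.\<close>
      also have "\<dots> \<le> (\<Sum>j<m. dist (y r (k + j)) (y r (k + j + 1)))"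
        using l(1) by (intro sum_mono2) auto
      finally show ?case by (simp add: infdist_nonneg)
    qed
  qed
  ultimately show ?thesis by blast
qed

end
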